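(* Let $E$ be a finite set, $e\in E$, and let $S\subseteq 2^E$ have $e$ as a frame, meaning: $\emptyset\in S$, $\{e\}\notin S$, and $e\in Y$ for every nonempty $Y\in S$. Let $S\setminus e:=\{Y\setminus\{e\}\mid Y\in S\}\subseteq 2^{E\setminus\{e\}}$. Then $S\setminus e$ is a powerful set (with ground set $E\setminus\{e\}$) if and only if $S$ is a powerful set.
   Context: For a finite ground set $E$, a family $S\subseteq 2^E$ is called a powerful set if for every $X\subseteq E$ the number of members $Y\in S$ with $Y\cap X=\emptyset$ is a power of $2$. *)

theory Defs
  imports Main
begin

definition powerful_set :: "'a set \<Rightarrow> 'a set set \<Rightarrow> bool" where
  "powerful_set E S \<longleftrightarrow>
     finite E \<and> S \<subseteq> Pow E \<and>
     (\<forall>X. X \<subseteq> E \<longrightarrow> (\<exists>k::nat. card {Y \<in> S. Y \<inter> X = {}} = 2 ^ k))"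

definition is_frame :: "'a \<Rightarrow> 'a set set \<Rightarrow> bool" where
  "is_frame e S \<longleftrightarrow> {} \<in> S \<and> {e} \<notin> S \<and> (\<forall>Y\<in>S. Y \<noteq> {} \<longrightarrow> e \<in> Y)"

definition remove_elem :: "'a set set \<Rightarrow> 'a \<Rightarrow> 'a set set" where
  "remove_elem S e = {Y - {e} | Y. Y \<in> S}"

end

theory Submission
  imports Defs
begin

text \<open>Separating the test sets \<open>X\<close> that avoid \<open>e\<close> from those that contain \<open>e\<close> shows that, whenever
  \<open>Y \<mapsto> Y - {e}\<close> is injective on \<open>S\<close>, the family \<open>S\<close> is powerful iff both the deletion and the
  contraction of \<open>e\<close> are. If \<open>e\<close> is a frame, this map is injective and the contraction is
  \<open>{{}}\<close>, which is powerful.\<close>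

text \<open>Named for the motivating case: if \<open>S\<close> is the cocycle space of a binary matroid, its members
  disjoint from \<open>X\<close> form the cocycle space of the contraction of \<open>X\<close>.\<close>

definition contract_set :: "'a set set \<Rightarrow> 'a set \<Rightarrow> 'a set set" where
  "contract_set S X = {Y \<in> S. Y \<inter> X = {}}"

lemma powerful_set_iff_contract_set:
  "powerful_set E S \<longleftrightarrow>
     finite E \<and> S \<subseteq> Pow E \<and> (\<forall>X\<in>Pow E. \<exists>k. card (contract_set S X) = 2 ^ k)"
  by (auto simp: powerful_set_def contract_set_def)

lemma contract_set_insert:
  "contract_set S (insert e X) = contract_set (contract_set S {e}) X"
  by (auto simp: contract_set_def)

lemma remove_elem_eq_image: "remove_elem S e = (\<lambda>Y. Y - {e}) ` S"
  by (auto simp: remove_elem_def)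

lemma card_remove_elem:
  assumes "inj_on (\<lambda>Y. Y - {e}) S"
  shows "card (remove_elem S e) = card S"
  unfolding remove_elem_eq_image using assms by (rule card_image)

lemma contract_set_remove_elem:
  assumes "e \<notin> X"
  shows "contract_set (remove_elem S e) X = remove_elem (contract_set S X) e"
  using assms by (auto simp: contract_set_def remove_elem_def)

lemma card_contract_set_remove_elem:
  assumes "inj_on (\<lambda>Y. Y - {e}) S" and "e \<notin> X"
  shows "card (contract_set (remove_elem S e) X) = card (contract_set S X)"
proof -
  have "contract_set S X \<subseteq> S"
    by (auto simp: contract_set_def)
  with assms(1) have "inj_on (\<lambda>Y. Y - {e}) (contract_set S X)"
    by (rule inj_on_subset)
  then show ?thesis
    by (simp add: contract_set_remove_elem[OF assms(2)] card_remove_elem)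
qed

lemma remove_elem_subset_Pow_iff: "remove_elem S e \<subseteq> Pow E \<longleftrightarrow> S \<subseteq> Pow (insert e E)"
  by (auto simp: remove_elem_def)

lemma powerful_set_insert_iff:
  assumes "e \<notin> E" and inj: "inj_on (\<lambda>Y. Y - {e}) S"
  shows "powerful_set (insert e E) S \<longleftrightarrow>
    powerful_set E (remove_elem S e) \<and> powerful_set E (contract_set S {e})"
proof -
  let ?pow2 = "\<lambda>T X. \<exists>k. card (contract_set T X) = 2 ^ k"
  have "(\<forall>X\<in>Pow (insert e E). ?pow2 S X) \<longleftrightarrow>
      (\<forall>X\<in>Pow E. ?pow2 S X) \<and> (\<forall>X\<in>Pow E. ?pow2 S (insert e X))"
    by (simp add: Pow_insert ball_Un)
  also have "(\<forall>X\<in>Pow E. ?pow2 S X) \<longleftrightarrow> (\<forall>X\<in>Pow E. ?pow2 (remove_elem S e) X)"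
  proof (rule ball_cong[OF refl])
    fix X assume "X \<in> Pow E"
    with \<open>e \<notin> E\<close> have "e \<notin> X"
      by blast
    then show "?pow2 S X \<longleftrightarrow> ?pow2 (remove_elem S e) X"
      by (simp add: card_contract_set_remove_elem[OF inj])
  qed
  finally have test_sets: "(\<forall>X\<in>Pow (insert e E). ?pow2 S X) \<longleftrightarrow>
      (\<forall>X\<in>Pow E. ?pow2 (remove_elem S e) X) \<and>
      (\<forall>X\<in>Pow E. ?pow2 (contract_set S {e}) X)"
    by (simp only: flip: contract_set_insert)
  have "contract_set S {e} \<subseteq> Pow E" if "S \<subseteq> Pow (insert e E)"
    using that by (auto simp: contract_set_def)
  then show ?thesis
    unfolding powerful_set_iff_contract_set test_sets remove_elem_subset_Pow_iff finite_insert
    by argo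
qed

lemma inj_on_Diff_singleton_iff:
  "inj_on (\<lambda>Y. Y - {e}) S \<longleftrightarrow> (\<forall>Y\<in>S. e \<notin> Y \<longrightarrow> insert e Y \<notin> S)"
proof (intro iffI ballI impI notI)
  fix Y assume inj: "inj_on (\<lambda>Y. Y - {e}) S" and "Y \<in> S" "e \<notin> Y" "insert e Y \<in> S"
  from inj _ \<open>insert e Y \<in> S\<close> \<open>Y \<in> S\<close> have "insert e Y = Y"
    by (rule inj_onD) simp
  with \<open>e \<notin> Y\<close> show False
    by blast
next
  assume no_twin: "\<forall>Y\<in>S. e \<notin> Y \<longrightarrow> insert e Y \<notin> S"
  show "inj_on (\<lambda>Y. Y - {e}) S"
  proof (rule inj_onI)
    fix Y Z assume "Y \<in> S" "Z \<in> S" and eq: "Y - {e} = Z - {e}"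
    from eq have "Y = Z \<or> e \<notin> Y \<and> Z = insert e Y \<or> e \<notin> Z \<and> Y = insert e Z"
      by blast
    with no_twin \<open>Y \<in> S\<close> \<open>Z \<in> S\<close> show "Y = Z"
      by blast
  qed
qed

lemma inj_on_Diff_frame:
  assumes "is_frame e S"
  shows "inj_on (\<lambda>Y. Y - {e}) S"
  unfolding inj_on_Diff_singleton_iff
proof (intro ballI impI)
  fix Y assume "Y \<in> S" "e \<notin> Y"
  with assms have "Y = {}"
    unfolding is_frame_def by blast
  with assms show "insert e Y \<notin> S"
    by (simp add: is_frame_def)
qed

lemma contract_set_frame:
  assumes "is_frame e S"
  shows "contract_set S {e} = {{}}"
  using assms by (auto simp: is_frame_def contract_set_def)

lemma powerful_set_singleton_empty:
  assumes "finite E"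
  shows "powerful_set E {{}}"
proof -
  have "card (contract_set {{}} X) = 2 ^ 0" for X :: "'a set"
    by (simp add: contract_set_def Collect_conv_if)
  with assms show ?thesis
    unfolding powerful_set_iff_contract_set by blast
qed

theorem theorem4:
  fixes E :: "'a set" and S :: "'a set set" and e :: 'a
  assumes "finite E" and "e \<in> E" and "S \<subseteq> Pow E" and "is_frame e S"
  shows "powerful_set (E - {e}) (remove_elem S e) \<longleftrightarrow> powerful_set E S"
proof -
  have "powerful_set E S \<longleftrightarrow> powerful_set (insert e (E - {e})) S"
    using \<open>e \<in> E\<close> by (simp add: insert_absorb)
  also have "\<dots> \<longleftrightarrow> powerful_set (E - {e}) (remove_elem S e) \<and>
      powerful_set (E - {e}) (contract_set S {e})"
    by (rule powerful_set_insert_iff) (simp_all add: inj_on_Diff_frame[OF \<open>is_frame e S\<close>])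
  also have "\<dots> \<longleftrightarrow> powerful_set (E - {e}) (remove_elem S e)"
    using \<open>finite E\<close>
    by (simp add: contract_set_frame[OF \<open>is_frame e S\<close>] powerful_set_singleton_empty)
  finally show ?thesis ..
qed

end
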